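(* Let $d = p_1^{\varepsilon_1}p_2^{\varepsilon_2}\cdots p_r^{\varepsilon_r}$, where $r\ge 1$, $p_1,\dots,p_r$ are distinct primes and $\varepsilon_1,\dots,\varepsilon_r\ge 1$ are integers, and let $d_k:=p_k^{\varepsilon_k}$. Let $(b,c)$ be a vector of $\mathbb{Z}_d^2$, and denote by $U(b,c)\subset\mathbb{Z}_d^2$ the set-theoretic union of all points of the projective line $\mathbb{P}_1(\mathbb{Z}_d)$ containing the vector $(b,c)$. Then $U(b,c)$ is a generating set for the submodule $(b,c)^\perp\subset\mathbb{Z}_d^2$. Furthermore, the equality $$U(b,c)=(b,c)^\perp$$ holds if, and only if, for each $k\in\{1,\dots,r\}$ the component vector $(b^{(k)},c^{(k)})\in\mathbb{Z}_{d_k}^2$ is either $(0,0)$ or an admissible pair over $\mathbb{Z}_{d_k}$.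
   Context: $\mathbb{Z}_n$ denotes the ring of integers modulo $n$. For $x\in\mathbb{Z}_d$, $x^{(k)}\in\mathbb{Z}_{d_k}$ denotes its reduction modulo $d_k$, and the component vectors of $(b,c)\in\mathbb{Z}_d^2$ are $(b^{(k)},c^{(k)})\in\mathbb{Z}_{d_k}^2$. Points: for an integer $n>1$, a vector (pair) $(x,y)\in\mathbb{Z}_n^2$ is called admissible if the map $\mathbb{Z}_n\to\mathbb{Z}_n^2$, $u\mapsto(ux,uy)$, is injective. A point of the projective line $\mathbb{P}_1(\mathbb{Z}_n)$ is a free cyclic submodule $\mathbb{Z}_n(x,y)=\{(ux,uy):u\in\mathbb{Z}_n\}$ with $(x,y)$ admissible, regarded as a set of vectors; $\mathbb{P}_1(\mathbb{Z}_n)$ is the set of all points. Perp-set: on $\mathbb{Z}_d^2$ let $[(b,c),(b',c')]:=cb'-c'b\in\mathbb{Z}_d$. Then $(b,c)^\perp:=\{(u,v)\in\mathbb{Z}_d^2:[(b,c),(u,v)]=0\}$, which is a $\mathbb{Z}_d$-submodule of $\mathbb{Z}_d^2$. *)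

theory Defs
  imports "HOL-Number_Theory.Residues" "HOL-Algebra.Module"
begin

abbreviation Zmod :: "nat \<Rightarrow> int ring"
  where "Zmod n \<equiv> residue_ring (int n)"

text \<open>
  The rank-two free module over \<^term>\<open>Zmod n\<close>. The record type of modules extends that of rings,
  so the fields \<^term>\<open>monoid.mult\<close> and \<^term>\<open>one\<close> have to be given a value; they take no part in
  the module structure.
\<close>

definition Zmod_square :: "nat \<Rightarrow> (int, int \<times> int) module"
  where "Zmod_square n =
    \<lparr>carrier = carrier (Zmod n) \<times> carrier (Zmod n),
     monoid.mult = \<lambda>(x, y) (x', y'). (x \<otimes>\<^bsub>Zmod n\<^esub> x', y \<otimes>\<^bsub>Zmod n\<^esub> y'),
     one = (\<one>\<^bsub>Zmod n\<^esub>, \<one>\<^bsub>Zmod n\<^esub>),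
     zero = (\<zero>\<^bsub>Zmod n\<^esub>, \<zero>\<^bsub>Zmod n\<^esub>),
     add = \<lambda>(x, y) (x', y'). (x \<oplus>\<^bsub>Zmod n\<^esub> x', y \<oplus>\<^bsub>Zmod n\<^esub> y'),
     smult = \<lambda>u (x, y). (u \<otimes>\<^bsub>Zmod n\<^esub> x, u \<otimes>\<^bsub>Zmod n\<^esub> y)\<rparr>"

definition admissible :: "nat \<Rightarrow> int \<times> int \<Rightarrow> bool"
  where "admissible n v \<longleftrightarrow>
    v \<in> carrier (Zmod_square n) \<and> inj_on (\<lambda>u. u \<odot>\<^bsub>Zmod_square n\<^esub> v) (carrier (Zmod n))"

definition cyclic_submodule :: "nat \<Rightarrow> int \<times> int \<Rightarrow> (int \<times> int) set"
  where "cyclic_submodule n v = (\<lambda>u. u \<odot>\<^bsub>Zmod_square n\<^esub> v) ` carrier (Zmod n)"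

definition projective_line :: "nat \<Rightarrow> (int \<times> int) set set"
  where "projective_line n = {cyclic_submodule n v | v. admissible n v}"

definition point_union :: "nat \<Rightarrow> int \<times> int \<Rightarrow> (int \<times> int) set"
  where "point_union n v = \<Union>{P \<in> projective_line n. v \<in> P}"

definition bracket :: "nat \<Rightarrow> int \<times> int \<Rightarrow> int \<times> int \<Rightarrow> int"
  where "bracket n = (\<lambda>(b, c) (b', c').
    (c \<otimes>\<^bsub>Zmod n\<^esub> b') \<ominus>\<^bsub>Zmod n\<^esub> (c' \<otimes>\<^bsub>Zmod n\<^esub> b))"

definition perp_set :: "nat \<Rightarrow> int \<times> int \<Rightarrow> (int \<times> int) set"
  where "perp_set n v = {w \<in> carrier (Zmod_square n). bracket n v w = \<zero>\<^bsub>Zmod n\<^esub>}"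

definition generated_submodule :: "nat \<Rightarrow> (int \<times> int) set \<Rightarrow> (int \<times> int) set"
  where "generated_submodule n S = \<Inter>{N. submodule N (Zmod n) (Zmod_square n) \<and> S \<subseteq> N}"

text \<open>Elements of \<^term>\<open>Zmod n\<close> are represented by their remainders in \<^term>\<open>{0..int n - 1}\<close>.\<close>

definition reduce_pair :: "nat \<Rightarrow> int \<times> int \<Rightarrow> int \<times> int"
  where "reduce_pair m = (\<lambda>(x, y). (x mod int m, y mod int m))"

lemma module_Zmod_square:
  assumes "1 < n"
  shows "module (Zmod n) (Zmod_square n)"
proof -
  interpret R: residues "int n" "Zmod n"
    using assms by unfold_locales simp_all
  show ?thesis
  proof (rule moduleI)
    show "cring (Zmod n)" by (rule R.cring)
    show "abelian_group (Zmod_square n)"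
    proof (rule abelian_groupI)
      fix v assume "v \<in> carrier (Zmod_square n)"
      then show "\<exists>w\<in>carrier (Zmod_square n). w \<oplus>\<^bsub>Zmod_square n\<^esub> v = \<zero>\<^bsub>Zmod_square n\<^esub>"
        by (intro bexI[of _ "(\<ominus>\<^bsub>Zmod n\<^esub> fst v, \<ominus>\<^bsub>Zmod n\<^esub> snd v)"])
          (auto simp: Zmod_square_def R.l_neg)
    qed (auto simp: Zmod_square_def R.a_ac)
  qed (auto simp: Zmod_square_def R.l_distr R.r_distr R.m_assoc)
qed

lemma bracket_eq: "1 < n \<Longrightarrow> bracket n (b, c) (u, v) = (c * u - v * b) mod int n"
proof -
  assume "1 < n"
  then interpret R: residues "int n" "Zmod n"
    by unfold_locales simp_all
  show ?thesis
    by (simp add: bracket_def a_minus_def R.res_add_eq R.res_mult_eq R.res_neg_eq mod_simps)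
qed

lemma submodule_perp_set:
  assumes "1 < n"
  shows "submodule (perp_set n v) (Zmod n) (Zmod_square n)"
proof -
  interpret R: residues "int n" "Zmod n"
    using assms by unfold_locales simp_all
  interpret M: module "Zmod n" "Zmod_square n"
    by (rule module_Zmod_square[OF assms])
  obtain b c where v: "v = (b, c)" by (cases v)
  have strip: "(c * (X mod int n) - (Y mod int n) * b) mod int n = (c * X - Y * b) mod int n" for X Y
    by (intro mod_diff_cong) (simp_all add: mod_mult_right_eq mod_mult_left_eq)
  have zero: "\<zero>\<^bsub>Zmod n\<^esub> = 0" by (simp add: residue_ring_def)
  have add: "x \<oplus>\<^bsub>Zmod_square n\<^esub> y \<in> perp_set n v"
    if "x \<in> perp_set n v" "y \<in> perp_set n v" for x y
  proof -
    obtain x1 x2 y1 y2 where xy: "x = (x1, x2)" "y = (y1, y2)" by (cases x, cases y)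
    have "int n dvd (c * x1 - x2 * b) + (c * y1 - y2 * b)"
      using that by (intro dvd_add) (auto simp: perp_set_def v xy bracket_eq[OF assms] zero)
    then have "bracket n v (x \<oplus>\<^bsub>Zmod_square n\<^esub> y) = 0"
      by (simp add: v xy bracket_eq[OF assms] Zmod_square_def R.res_add_eq strip)
        (simp add: algebra_simps)
    then show ?thesis
      using that by (auto simp: perp_set_def zero)
  qed
  have smul: "a \<odot>\<^bsub>Zmod_square n\<^esub> x \<in> perp_set n v"
    if "a \<in> carrier (Zmod n)" "x \<in> perp_set n v" for a x
  proof -
    obtain x1 x2 where x: "x = (x1, x2)" by (cases x)
    have "int n dvd a * (c * x1 - x2 * b)"
      using that by (intro dvd_mult) (auto simp: perp_set_def v x bracket_eq[OF assms] zero)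
    then have "bracket n v (a \<odot>\<^bsub>Zmod_square n\<^esub> x) = 0"
      by (simp add: v x bracket_eq[OF assms] Zmod_square_def R.res_mult_eq strip)
        (simp add: algebra_simps)
    then show ?thesis
      using that by (auto simp: perp_set_def zero)
  qed
  show ?thesis
  proof (rule M.submoduleI)
    show "perp_set n v \<subseteq> carrier (Zmod_square n)" by (auto simp: perp_set_def)
    show "\<zero>\<^bsub>Zmod_square n\<^esub> \<in> perp_set n v"
      using M.M.zero_closed
      by (auto simp: perp_set_def v zero bracket_eq[OF assms] Zmod_square_def)
    fix x assume x: "x \<in> perp_set n v"
    then have xc: "x \<in> carrier (Zmod_square n)" by (auto simp: perp_set_def)
    have "\<ominus>\<^bsub>Zmod_square n\<^esub> x = (\<ominus>\<^bsub>Zmod n\<^esub> \<one>\<^bsub>Zmod n\<^esub>) \<odot>\<^bsub>Zmod_square n\<^esub> x"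
      using M.smult_l_minus[OF R.one_closed xc] M.smult_one[OF xc] by simp
    then show "\<ominus>\<^bsub>Zmod_square n\<^esub> x \<in> perp_set n v"
      using smul[OF R.a_inv_closed[OF R.one_closed] x] by simp
  qed (fact add smul)+
qed

end

(* Put g = gcd(b, c, d) and m = d/g. Then (b, c) is g times a vector v that is primitive over the
   integers, and v extends to a basis v, w of determinant 1. In this basis the perp-set consists of
   the vectors whose second coordinate is divisible by m. It is generated by v and v + m w, both of
   which span points through (b, c). If g and m are coprime, a point through (b, c) and a given
   vector of the perp-set is glued by the Chinese remainder theorem. Conversely a point containing
   both g v and m w forces coprimality: modulo a common prime factor of g and m, its spanning
   vector would have to be a multiple of v because of g v and of w because of m w. Finally g and m
   are coprime iff every d_k divides gcd(b, c) or p_k does not. *)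
theory Submission
  imports Defs
begin

section \<open>Vectors modulo n as pairs of integers\<close>

lemma carrier_Zmod_square:
  "(x, y) \<in> carrier (Zmod_square n) \<longleftrightarrow> x \<in> {0..int n - 1} \<and> y \<in> {0..int n - 1}"
  by (auto simp: Zmod_square_def residue_ring_def)

lemma smult_Zmod_square: "u \<odot>\<^bsub>Zmod_square n\<^esub> (x, y) = (u * x mod int n, u * y mod int n)"
  by (simp add: Zmod_square_def residue_ring_def)

lemma add_Zmod_square:
  "(x, y) \<oplus>\<^bsub>Zmod_square n\<^esub> (x', y') = ((x + x') mod int n, (y + y') mod int n)"
  by (simp add: Zmod_square_def residue_ring_def)

lemma gcd_reduce_pair:
  fixes x y n :: int
  shows "gcd (gcd (x mod n) (y mod n)) n = gcd (gcd x y) n"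
proof -
  have red: "gcd (z mod n) n = gcd z n" for z
    using gcd_red_int[of z n] by (simp only: gcd.commute)
  have "gcd (gcd (x mod n) (y mod n)) n = gcd (x mod n) (gcd y n)"
    by (simp only: gcd.assoc red)
  also have "\<dots> = gcd y (gcd (x mod n) n)" by (rule gcd.left_commute)
  also have "\<dots> = gcd (gcd x y) n" by (simp only: red gcd.assoc gcd.left_commute)
  finally show ?thesis .
qed

text \<open>If h = gcd(x, y, n) exceeds 1, the nonzero residue n/h annihilates the pair, just as 0
  does. If h = 1, divisibility of (u - u') x and (u - u') y by n passes to (u - u') gcd(x, y), and
  the gcd cancels.\<close>

lemma admissible_iff:
  assumes "1 < n"
  shows "admissible n (x, y) \<longleftrightarrow> (x, y) \<in> carrier (Zmod_square n) \<and> coprime (gcd x y) (int n)"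
proof -
  let ?h = "gcd (gcd x y) (int n)"
  have inj: "inj_on (\<lambda>u. u \<odot>\<^bsub>Zmod_square n\<^esub> (x, y)) {0..int n - 1}" if cop: "coprime (gcd x y) (int n)"
  proof (rule inj_onI)
    fix u u' assume u: "u \<in> {0..int n - 1}" "u' \<in> {0..int n - 1}"
      and eq: "u \<odot>\<^bsub>Zmod_square n\<^esub> (x, y) = u' \<odot>\<^bsub>Zmod_square n\<^esub> (x, y)"
    have "int n dvd (u - u') * x" "int n dvd (u - u') * y"
      using eq by (auto simp: smult_Zmod_square mod_eq_dvd_iff algebra_simps)
    then have "int n dvd gcd ((u - u') * x) ((u - u') * y)" by simp
    then have "int n dvd (u - u') * gcd x y" by (simp add: gcd_mult_left)
    then have "int n dvd u - u'"
      using cop by (simp add: coprime_commute coprime_dvd_mult_left_iff)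
    then show "u = u'" using u by (metis atLeastAtMost_iff mod_eq_dvd_iff mod_pos_pos_trivial zle_diff1_eq)
  qed
  have cop: "coprime (gcd x y) (int n)" if inj: "inj_on (\<lambda>u. u \<odot>\<^bsub>Zmod_square n\<^esub> (x, y)) {0..int n - 1}"
  proof (rule ccontr)
    assume "\<not> coprime (gcd x y) (int n)"
    then have "?h \<noteq> 1" by (simp add: coprime_iff_gcd_eq_1)
    moreover have "?h > 0" using assms by (simp add: gcd_pos_int)
    ultimately have h: "?h > 1" by linarith
    obtain u where u: "int n = ?h * u" by (meson dvd_def gcd_dvd2)
    have u0: "0 < u" using u assms h by (intro zero_less_mult_pos[of ?h u]) auto
    have un: "u < int n" using mult_strict_right_mono[OF h u0] u by simp
    have "?h dvd x" "?h dvd y" by (meson dvd_trans gcd_dvd1 gcd_dvd2)+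
    then have "int n dvd u * x" "int n dvd u * y" by (metis u mult.commute mult_dvd_mono dvd_refl)+
    then have "u \<odot>\<^bsub>Zmod_square n\<^esub> (x, y) = 0 \<odot>\<^bsub>Zmod_square n\<^esub> (x, y)"
      by (simp add: smult_Zmod_square)
    then show False using inj u0 un by (auto dest: inj_onD)
  qed
  show ?thesis
    using inj cop by (auto simp: admissible_def residue_ring_def)
qed

text \<open>Trades points and residues for congruences between arbitrary integers. The spanning
  vector and the factors need not be reduced, since reducing a vector modulo n does not change its
  gcd with n. Later constructions can therefore work with integer vectors.\<close>

lemma point_union_iff:
  assumes "1 < n"
  shows "(u, v) \<in> point_union n (b, c) \<longleftrightarrow>
    (u, v) \<in> carrier (Zmod_square n) \<and> (b, c) \<in> carrier (Zmod_square n) \<and>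
    (\<exists>x y s t. coprime (gcd x y) (int n) \<and>
      [b = t * x] (mod int n) \<and> [c = t * y] (mod int n) \<and>
      [u = s * x] (mod int n) \<and> [v = s * y] (mod int n))"
    (is "?L \<longleftrightarrow> ?C \<and> ?B \<and> ?R")
proof
  assume ?L
  then obtain x y s t where a: "admissible n (x, y)"
    and "(b, c) = t \<odot>\<^bsub>Zmod_square n\<^esub> (x, y)" "(u, v) = s \<odot>\<^bsub>Zmod_square n\<^esub> (x, y)"
    unfolding point_union_def projective_line_def cyclic_submodule_def by force
  moreover have "coprime (gcd x y) (int n)" using a admissible_iff[OF assms] by blast
  moreover have "[t * z mod int n = t * z] (mod int n)" for t z by simp
  ultimately have ?R by (metis smult_Zmod_square prod.inject)
  then show "?C \<and> ?B \<and> ?R"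
    using assms \<open>(b, c) = _\<close> \<open>(u, v) = _\<close> by (simp add: smult_Zmod_square carrier_Zmod_square)
next
  assume r: "?C \<and> ?B \<and> ?R"
  then obtain x y s t where cop: "coprime (gcd x y) (int n)"
    and bc: "[b = t * x] (mod int n)" "[c = t * y] (mod int n)"
    and uv: "[u = s * x] (mod int n)" "[v = s * y] (mod int n)" by blast
  let ?z = "(x mod int n, y mod int n)"
  have a: "admissible n ?z"
    using assms cop by (simp add: gcd_reduce_pair admissible_iff carrier_Zmod_square coprime_iff_gcd_eq_1)
  have mem: "(b', c') \<in> cyclic_submodule n ?z"
    if "(b', c') \<in> carrier (Zmod_square n)" "[b' = t' * x] (mod int n)" "[c' = t' * y] (mod int n)" for b' c' t'
  proof -
    have "(b', c') = (t' mod int n) \<odot>\<^bsub>Zmod_square n\<^esub> ?z"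
      using that by (simp add: smult_Zmod_square carrier_Zmod_square cong_def mod_simps)
    then show ?thesis using assms unfolding cyclic_submodule_def residue_ring_def by force
  qed
  have "(b, c) \<in> cyclic_submodule n ?z" "(u, v) \<in> cyclic_submodule n ?z"
    using r bc uv mem by blast+
  then show ?L unfolding point_union_def projective_line_def using a by blast
qed

lemma perp_set_iff:
  assumes "1 < n"
  shows "(u, v) \<in> perp_set n (b, c) \<longleftrightarrow>
    (u, v) \<in> carrier (Zmod_square n) \<and> int n dvd c * u - v * b"
  using assms by (auto simp: perp_set_def bracket_eq residue_ring_def)

text \<open>Two multiples of one vector have determinant zero.\<close>

lemma point_union_subset_perp_set:
  assumes "1 < n"
  shows "point_union n (b, c) \<subseteq> perp_set n (b, c)"
proof (clarify)
  fix u v assume "(u, v) \<in> point_union n (b, c)"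
  then obtain x y s t where car: "(u, v) \<in> carrier (Zmod_square n)"
    and bc: "[b = t * x] (mod int n)" "[c = t * y] (mod int n)"
    and uv: "[u = s * x] (mod int n)" "[v = s * y] (mod int n)"
    using point_union_iff[OF assms] by blast
  have "[c * u - v * b = (t * y) * (s * x) - (s * y) * (t * x)] (mod int n)"
    using bc uv by (intro cong_diff cong_mult)
  then show "(u, v) \<in> perp_set n (b, c)"
    using car by (simp add: perp_set_iff[OF assms] cong_iff_dvd_diff algebra_simps)
qed

section \<open>Lifting to primitive integer vectors\<close>

text \<open>Take for k the product of the primes of c that do not divide a. A prime of c not
  dividing a divides k, hence not a + k m. A prime of c dividing a divides neither m, by the gcd
  hypothesis, nor k, hence again not a + k m.\<close>

lemma coprime_shift:
  fixes a m c :: int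
  assumes "c \<noteq> 0" "coprime (gcd a m) c"
  obtains k where "coprime (a + k * m) c"
proof -
  define k where "k = \<Prod>{p \<in> prime_factors c. \<not> p dvd a}"
  have "coprime (a + k * m) c"
  proof (rule ccontr)
    assume "\<not> coprime (a + k * m) c"
    then obtain p where p: "prime p" "p dvd a + k * m" "p dvd c"
      using prime_divisor_exists[of "gcd (a + k * m) c"] assms(1)
      by (auto simp: coprime_iff_gcd_eq_1)
    show False
    proof (cases "p dvd a")
      case True
      then have "p dvd k * m" using p by (simp add: dvd_add_right_iff)
      moreover have "\<not> p dvd m"
        using True p assms(2) by (meson coprime_common_divisor gcd_greatest not_prime_unit)
      ultimately have "p dvd k" using p(1) by (simp add: prime_dvd_mult_iff)
      then obtain q where "q \<in> prime_factors c" "\<not> q dvd a" "p dvd q"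
        using p(1) by (auto simp: k_def prime_dvd_prod_iff)
      then show False using True p(1) by (metis in_prime_factors_imp_prime primes_dvd_imp_eq)
    next
      case False
      then have "p dvd k"
        using p assms(1) by (auto simp: k_def prime_factors_dvd intro!: dvd_prodI)
      then show False using p(2) False by (simp add: dvd_add_left_iff)
    qed
  qed
  then show thesis using that by blast
qed

text \<open>Dividing by g leaves a pair that is coprime only together with m = d/g. Shifting its
  first entry by a multiple of m changes g times that entry by a multiple of d, and
  \<open>coprime_shift\<close> provides a shift that makes the pair coprime over the
  integers.\<close>

lemma primitive_lift:
  fixes b c d :: int
  assumes "0 < d"
  defines "g \<equiv> gcd (gcd b c) d"
  obtains x y where "coprime x y" "[b = g * x] (mod d)" "[c = g * y] (mod d)"
proof -
  \<comment> \<open>A second entry 0 is replaced by the congruent value \<open>d\<close>: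
    \<open>coprime_shift\<close> needs a nonzero number, and the gcd with \<open>d\<close> stays the
    same.\<close>
  define c' where "c' = (if c = 0 then d else c)"
  have c': "c' \<noteq> 0" "[c = c'] (mod d)" using assms by (auto simp: c'_def cong_def)
  have g: "g = gcd (gcd b d) c'"
    by (simp add: g_def c'_def gcd.assoc gcd.commute gcd.left_commute)
  obtain b1 c1 m where f: "b = g * b1" "c' = g * c1" "d = g * m"
    by (metis g dvd_def dvd_trans gcd_dvd1 gcd_dvd2)
  have g0: "g > 0" using assms by (simp add: g_def gcd_pos_int)
  have "g = g * gcd (gcd b1 m) c1"
    using g0 by (subst g, subst f(1), subst f(2), subst f(3)) (simp add: gcd_mult_left)
  then have "coprime (gcd b1 m) c1" using g0 by (simp add: coprime_iff_gcd_eq_1)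
  moreover have "c1 \<noteq> 0" using c' f by auto
  ultimately obtain k where k: "coprime (b1 + k * m) c1" using coprime_shift by blast
  show thesis
  proof (rule that[OF k])
    have "g * (b1 + k * m) = b + k * d" using f by (simp add: algebra_simps)
    then show "[b = g * (b1 + k * m)] (mod d)" by (simp add: cong_def)
    show "[c = g * c1] (mod d)" using c' f by simp
  qed
qed


text \<open>Modulo d the form c u - v b is -g times the determinant of (x, y) and (u, v), so the
  factor g cancels from d = g m. The Bezout coefficients give the complementary vector (-B, A),
  which forms with (x, y) a basis of determinant 1. In it, (u, v) has the coordinates A u + B v and
  x v - y u.\<close>

lemma lifted_point:
  fixes b c d g m :: int
  assumes "0 < d" "d = g * m" "g = gcd (gcd b c) d"
  obtains x y A B where "A * x + B * y = 1" "[b = g * x] (mod d)" "[c = g * y] (mod d)"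
    "\<And>u v. d dvd c * u - v * b \<longleftrightarrow> m dvd x * v - y * u"
proof -
  obtain x y where xy: "coprime x y" "[b = g * x] (mod d)" "[c = g * y] (mod d)"
    using primitive_lift[OF assms(1)] assms(3) by metis
  obtain A B where AB: "A * x + B * y = 1"
    using bezout_int[of x y] xy(1) by auto
  have "d dvd c * u - v * b \<longleftrightarrow> m dvd x * v - y * u" for u v
  proof -
    have "[c * u - v * b = (g * y) * u - v * (g * x)] (mod d)"
      using xy by (intro cong_diff cong_mult) auto
    then have "d dvd c * u - v * b \<longleftrightarrow> d dvd (g * y) * u - v * (g * x)"
      by (rule cong_dvd_iff)
    also have "(g * y) * u - v * (g * x) = - (g * (x * v - y * u))"
      by (simp add: algebra_simps)
    also have "d dvd \<dots> \<longleftrightarrow> m dvd x * v - y * u"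
      using assms(1,2) by auto
    finally show ?thesis .
  qed
  then show thesis using that[OF AB xy(2,3)] by blast
qed

section \<open>Generation of the perp-set\<close>

lemma perp_set_subset_submodule:
  assumes n: "1 < n" and bc: "(b, c) \<in> carrier (Zmod_square n)"
    and N: "submodule N (Zmod n) (Zmod_square n)" "point_union n (b, c) \<subseteq> N"
  shows "perp_set n (b, c) \<subseteq> N"
proof (clarify)
  fix u v assume uv: "(u, v) \<in> perp_set n (b, c)"
  define g where "g = gcd (gcd b c) (int n)"
  obtain m where m: "int n = g * m" unfolding g_def by (meson dvd_def gcd_dvd2)
  obtain x y A B where AB: "A * x + B * y = 1" and xy: "[b = g * x] (mod int n)" "[c = g * y] (mod int n)"
    and perp: "\<And>u v. int n dvd c * u - v * b \<longleftrightarrow> m dvd x * v - y * u"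
    using lifted_point[OF _ m g_def] n by (metis (no_types) of_nat_0_less_iff less_trans zero_less_one)
  obtain k where k: "x * v - y * u = m * k"
    using uv perp perp_set_iff[OF n] by (meson dvd_def)
  \<comment> \<open>This is (x, y) + m (-B, A). It satisfies the Bezout relation with the same
    \<open>A\<close> and \<open>B\<close>, and g times it is still (b, c) modulo n because g m =
    n.\<close>
  define x' y' where "x' = x - m * B" and "y' = y + m * A"
  have mem: "(z mod int n, w mod int n) \<in> N"
    if "P * z + Q * w = 1" "[b = g * z] (mod int n)" "[c = g * w] (mod int n)" for P Q z w
  proof -
    have "coprime z w" using that(1) by (metis coprimeI dvd_add dvd_mult)
    then have zw: "coprime (gcd z w) (int n)" by (simp add: coprime_iff_gcd_eq_1)
    \<comment> \<open>The vector spans its own point (\<open>s = 1\<close>), which contains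
      \<open>(b, c)\<close> with the factor \<open>t = g\<close>.\<close>
    have "\<exists>x y s t. coprime (gcd x y) (int n) \<and>
        [b = t * x] (mod int n) \<and> [c = t * y] (mod int n) \<and>
        [z mod int n = s * x] (mod int n) \<and> [w mod int n = s * y] (mod int n)"
      by (rule exI[of _ z], rule exI[of _ w], rule exI[of _ 1], rule exI[of _ g])
        (use that zw in simp)
    then have "(z mod int n, w mod int n) \<in> point_union n (b, c)"
      using n bc by (simp add: point_union_iff carrier_Zmod_square)
    then show ?thesis using N by blast
  qed
  have v0: "(x mod int n, y mod int n) \<in> N" using mem[OF AB xy] .
  have v1: "(x' mod int n, y' mod int n) \<in> N"
  proof (rule mem)
    show "A * x' + B * y' = 1" using AB by (simp add: x'_def y'_def algebra_simps)
    have "[g * x = g * x'] (mod int n)" "[g * y = g * y'] (mod int n)"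
      by (simp_all add: m x'_def y'_def cong_iff_dvd_diff algebra_simps)
    then show "[b = g * x'] (mod int n)" "[c = g * y'] (mod int n)"
      using xy by (meson cong_trans)+
  qed
  \<comment> \<open>The coordinates of \<open>(u, v)\<close> are A u + B v and m k. The term k (x',
    y') supplies the second one and also k copies of (x, y), which are subtracted here.\<close>
  define \<alpha> where "\<alpha> = A * u + B * v - k"
  have smul: "(a * z mod int n, a * w mod int n) \<in> N" if "(z mod int n, w mod int n) \<in> N" for a z w
  proof -
    have "(a mod int n) \<odot>\<^bsub>Zmod_square n\<^esub> (z mod int n, w mod int n) \<in> N"
      using submodule.smult_closed[OF N(1) _ that, of "a mod int n"] n by (simp add: residue_ring_def)
    then show ?thesis by (simp add: smult_Zmod_square mod_simps)
  qed
  have "((\<alpha> * x + k * x') mod int n, (\<alpha> * y + k * y') mod int n) \<in> N"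
    using subgroup.m_closed[OF submodule.axioms(1)[OF N(1)] smul[OF v0, of \<alpha>] smul[OF v1, of k]]
    by (simp add: add_Zmod_square mod_simps)
  moreover have "\<alpha> * x + k * x' = u"
  proof -
    have "\<alpha> * x + k * x' = (A * u + B * v) * x - (m * k) * B" by (simp add: \<alpha>_def x'_def algebra_simps)
    also have "\<dots> = (A * x + B * y) * u" unfolding k[symmetric] by (simp add: algebra_simps)
    finally show ?thesis using AB by simp
  qed
  moreover have "\<alpha> * y + k * y' = v"
  proof -
    have "\<alpha> * y + k * y' = (A * u + B * v) * y + (m * k) * A" by (simp add: \<alpha>_def y'_def algebra_simps)
    also have "\<dots> = (A * x + B * y) * v" unfolding k[symmetric] by (simp add: algebra_simps)
    finally show ?thesis using AB by simp
  qed
  moreover have "(u mod int n, v mod int n) = (u, v)"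
    using uv by (simp add: perp_set_iff[OF n] carrier_Zmod_square)
  ultimately show "(u, v) \<in> N" by simp
qed

lemma generated_submodule_point_union:
  assumes "1 < n" "(b, c) \<in> carrier (Zmod_square n)"
  shows "generated_submodule n (point_union n (b, c)) = perp_set n (b, c)"
proof
  show "generated_submodule n (point_union n (b, c)) \<subseteq> perp_set n (b, c)"
    unfolding generated_submodule_def
    using submodule_perp_set[OF assms(1)] point_union_subset_perp_set[OF assms(1)] by blast
  show "perp_set n (b, c) \<subseteq> generated_submodule n (point_union n (b, c))"
    unfolding generated_submodule_def using perp_set_subset_submodule[OF assms] by blast
qed

section \<open>The equality criterion\<close>

text \<open>Modulo m, a vector (u, v) of the perp-set is a multiple of (x, y), because its second
  coordinate is divisible by m. Modulo g, the vector (b, c) vanishes, so there only (u, v) restricts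
  the spanning vector, and a primitive vector (x0, y0) in the direction of (u, v) will do.\<close>

lemma perp_set_subset_point_union:
  assumes n: "1 < n" and bc: "(b, c) \<in> carrier (Zmod_square n)"
    and m: "int n = g * m" and g: "g = gcd (gcd b c) (int n)" and cop: "coprime g m"
  shows "perp_set n (b, c) \<subseteq> point_union n (b, c)"
proof (clarify)
  fix u v assume uv: "(u, v) \<in> perp_set n (b, c)"
  obtain x y A B where AB: "A * x + B * y = 1" and xy: "[b = g * x] (mod int n)" "[c = g * y] (mod int n)"
    and perp: "\<And>u v. int n dvd c * u - v * b \<longleftrightarrow> m dvd x * v - y * u"
    using lifted_point[OF _ m g] n by (metis (no_types) of_nat_0_less_iff less_trans zero_less_one)
  obtain k where k: "x * v - y * u = m * k"
    using uv perp perp_set_iff[OF n] by (meson dvd_def)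
  define h where "h = gcd (gcd u v) (int n)"
  obtain x0 y0 where xy0: "coprime x0 y0" "[u = h * x0] (mod int n)" "[v = h * y0] (mod int n)"
    using primitive_lift[of "int n" u v] n unfolding h_def by auto
  obtain e1 e2 where e: "e1 * g + e2 * m = 1" using bezout_int[of g m] cop by auto
  define \<alpha> where "\<alpha> = A * u + B * v"
  have u: "u = \<alpha> * x - m * (k * B)"
  proof -
    have "\<alpha> * x - m * (k * B) = (A * u + B * v) * x - (m * k) * B" by (simp add: \<alpha>_def algebra_simps)
    also have "\<dots> = (A * x + B * y) * u" unfolding k[symmetric] by (simp add: algebra_simps)
    finally show ?thesis using AB by simp
  qed
  have v: "v = \<alpha> * y + m * (k * A)"
  proof -
    have "\<alpha> * y + m * (k * A) = (A * u + B * v) * y + (m * k) * A" by (simp add: \<alpha>_def algebra_simps)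
    also have "\<dots> = (A * x + B * y) * v" unfolding k[symmetric] by (simp add: algebra_simps)
    finally show ?thesis using AB by simp
  qed
  \<comment> \<open>The coefficient \<open>e1 * g\<close> is 1 modulo \<open>m\<close> and 0 modulo
    \<open>g\<close>, and \<open>e2 * m\<close> the reverse. The factor \<open>s\<close> is glued
    from the two factors of \<open>(u, v)\<close>: \<open>\<alpha>\<close> modulo \<open>m\<close>
    and \<open>h\<close> modulo \<open>g\<close>.\<close>
  define X Y s where "X = e1 * g * x + e2 * m * x0" and "Y = e1 * g * y + e2 * m * y0"
    and "s = e1 * g * \<alpha> + e2 * m * h"
  have one: "[e1 * g = 1] (mod m)" "[e2 * m = 1] (mod g)"
    using e by (metis cong_add_lcancel_0 cong_iff_lin mult.commute add.commute)+
  \<comment> \<open>\<open>(X, Y)\<close> is glued by the Chinese remainder theorem from \<open>(x, y)\<close> modulo \<open>m\<close> and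
    \<open>(x0, y0)\<close> modulo \<open>g\<close>; it spans a point containing both vectors.\<close>
  have glue: "[e1 * g * p + e2 * m * q = p] (mod m)" "[e1 * g * p + e2 * m * q = q] (mod g)" for p q
  proof -
    have "[e1 * g * p + e2 * m * q = 1 * p + 0] (mod m)"
      using one by (intro cong_add cong_mult) (auto simp: cong_def)
    then show "[e1 * g * p + e2 * m * q = p] (mod m)" by simp
    have "[e1 * g * p + e2 * m * q = 0 + 1 * q] (mod g)"
      using one by (intro cong_add cong_mult) (auto simp: cong_def)
    then show "[e1 * g * p + e2 * m * q = q] (mod g)" by simp
  qed
  have both: "[p = q] (mod int n)" if "[p = q] (mod g)" "[p = q] (mod m)" for p q
    using that cop unfolding m by (simp add: cong_iff_dvd_diff divides_mult)
  have coprime_xy: "coprime x y" using AB by (metis coprimeI dvd_add dvd_mult)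
  have coprime_XY: "coprime (gcd X Y) (int n)"
  proof -
    have cong_gcd2: "coprime (gcd P Q) l" if "coprime p q" "[P = p] (mod l)" "[Q = q] (mod l)" for P Q p q l :: int
    proof (rule coprimeI)
      fix e assume e: "e dvd gcd P Q" "e dvd l"
      then have "e dvd p" "e dvd q" using that by (meson cong_dvd_iff cong_dvd_modulus dvd_trans gcd_dvd1 gcd_dvd2)+
      then show "is_unit e" using that(1) by (meson coprime_common_divisor)
    qed
    show ?thesis unfolding m X_def Y_def
      using cong_gcd2[OF xy0(1) glue(2) glue(2)] cong_gcd2[OF coprime_xy glue(1) glue(1)] by simp
  qed
  \<comment> \<open>Since n = g m, agreement modulo \<open>m\<close> suffices after multiplication
    by \<open>g\<close>; hence (X, Y) reaches (b, c) with the factor \<open>g\<close>.\<close>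
  have scale: "[g * z = g * w] (mod int n)" if "[z = w] (mod m)" for z w
    using that unfolding m cong_iff_dvd_diff by (metis mult_dvd_mono dvd_refl right_diff_distrib)
  have b: "[b = g * X] (mod int n)" and c: "[c = g * Y] (mod int n)"
    using xy scale[OF glue(1)] unfolding X_def Y_def by (meson cong_sym cong_trans)+
  have modg: "[z = s * (e1 * g * p + e2 * m * q)] (mod g)" if "[z = h * q] (mod int n)" for z p q
  proof -
    have "[s * (e1 * g * p + e2 * m * q) = h * q] (mod g)"
      unfolding s_def by (intro cong_mult glue)
    moreover have "[z = h * q] (mod g)" using that m by (metis cong_dvd_modulus dvd_triv_left)
    ultimately show ?thesis by (meson cong_sym cong_trans)
  qed
  have modm: "[z = s * (e1 * g * p + e2 * m * q)] (mod m)" if "[z = \<alpha> * p] (mod m)" for z p q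
  proof -
    have "[s * (e1 * g * p + e2 * m * q) = \<alpha> * p] (mod m)"
      unfolding s_def by (intro cong_mult glue)
    then show ?thesis using that by (meson cong_sym cong_trans)
  qed
  have "[u = \<alpha> * x] (mod m)" "[v = \<alpha> * y] (mod m)"
    by (subst u, simp add: cong_iff_dvd_diff, subst v, simp add: cong_iff_dvd_diff)
  then have "[u = s * X] (mod int n)" "[v = s * Y] (mod int n)"
    using modg modm xy0 unfolding X_def Y_def by (blast intro: both)+
  then show "(u, v) \<in> point_union n (b, c)"
    using coprime_XY b c uv bc by (auto simp: point_union_iff[OF n] perp_set_iff[OF n])
qed

text \<open>The test vector is m (-B, A). A point through it and (b, c) is spanned by some (z, w),
  whose second coordinate Y in the basis is divisible by m on account of (b, c), and invertible
  modulo g on account of the test vector. A common divisor of g and m then divides 1.\<close>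

lemma coprime_if_perp_set_subset_point_union:
  assumes n: "1 < n" and m: "int n = g * m" and g: "g = gcd (gcd b c) (int n)"
    and sub: "perp_set n (b, c) \<subseteq> point_union n (b, c)"
  shows "coprime g m"
proof -
  obtain x y A B where AB: "A * x + B * y = 1" and xy: "[b = g * x] (mod int n)" "[c = g * y] (mod int n)"
    and perp: "\<And>u v. int n dvd c * u - v * b \<longleftrightarrow> m dvd x * v - y * u"
    using lifted_point[OF _ m g] n by (metis (no_types) of_nat_0_less_iff less_trans zero_less_one)
  have g0: "g > 0" using g n by simp
  then have m0: "m > 0" using m n by (metis of_nat_0_less_iff zero_less_mult_pos less_trans zero_less_one)
  define u v where "u = (- (m * B)) mod int n" and "v = (m * A) mod int n"
  have cuv: "[u = - (m * B)] (mod int n)" "[v = m * A] (mod int n)"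
    by (simp_all add: u_def v_def)
  have mn: "m dvd int n" "g dvd int n" using m by auto
  have "[x * v - y * u = x * (m * A) - y * (- (m * B))] (mod m)"
    using cuv mn by (intro cong_diff cong_mult cong_refl) (auto intro: cong_dvd_modulus)
  then have "m dvd x * v - y * u" by (simp add: cong_dvd_iff)
  then have "(u, v) \<in> perp_set n (b, c)"
    using n by (simp add: perp_set_iff perp carrier_Zmod_square u_def v_def)
  then have "(u, v) \<in> point_union n (b, c)" using sub by blast
  then obtain z w s t where cop: "coprime (gcd z w) (int n)" and
    t: "[b = t * z] (mod int n)" "[c = t * w] (mod int n)" and
    s: "[u = s * z] (mod int n)" "[v = s * w] (mod int n)"
    using point_union_iff[OF n] by blast
  have tg: "[g * x = t * z] (mod int n)" "[g * y = t * w] (mod int n)"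
    using t xy by (meson cong_sym cong_trans)+
  have sm: "[- (m * B) = s * z] (mod int n)" "[m * A = s * w] (mod int n)"
    using s cuv by (meson cong_sym cong_trans)+
  \<comment> \<open>A divisor of n is coprime to gcd(z, w), so it divides every factor that takes
    (z, w) into its multiples. This yields \<open>g dvd t\<close> and
    \<open>m dvd s\<close>.\<close>
  have cancel: "l dvd r" if "l dvd int n" "l dvd r * z" "l dvd r * w" for l r
  proof -
    have "l dvd r * gcd z w" using that(2,3) by (metis gcd_greatest dvd_abs_iff abs_mult abs_gcd_int gcd_mult_distrib_int)
    moreover have "coprime l (gcd z w)" using cop that(1) by (meson coprime_commute coprime_divisors dvd_refl)
    ultimately show ?thesis by (simp add: coprime_dvd_mult_left_iff)
  qed
  have tr: "l dvd q" if "[p = q] (mod int n)" "l dvd int n" "l dvd p" for l p q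
    using that by (meson cong_dvd_iff cong_dvd_modulus)
  have "g dvd t" by (rule cancel[OF mn(2)]) (rule tr[OF tg(1) mn(2)], simp, rule tr[OF tg(2) mn(2)], simp)
  then obtain t' where t': "t = g * t'" by (rule dvdE)
  have "m dvd s" by (rule cancel[OF mn(1)]) (rule tr[OF sm(1) mn(1)], simp, rule tr[OF sm(2) mn(1)], simp)
  then obtain s' where s': "s = m * s'" by (rule dvdE)
  \<comment> \<open>\<open>(z, w)\<close> has the coordinates \<open>A z + B w\<close> and \<open>Y\<close> with respect to the basis \<open>(x, y)\<close>,
    \<open>(- B, A)\<close>.\<close>
  define Y where "Y = x * w - y * z"
  \<comment> \<open>First coordinates of g (x, y) and t (z, w) are compared. Dividing by g makes t'
    invertible modulo m.\<close>
  have "[A * (g * x) + B * (g * y) = A * (t * z) + B * (t * w)] (mod int n)"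
    using tg by (intro cong_add cong_mult[OF cong_refl])
  also have "A * (g * x) + B * (g * y) = g * (A * x + B * y)" by (simp add: algebra_simps)
  finally have "g * m dvd g * (1 - t' * (A * z + B * w))"
    unfolding AB m by (simp add: cong_iff_dvd_diff t' algebra_simps)
  then have X1: "m dvd 1 - t' * (A * z + B * w)" using g0 by simp
  \<comment> \<open>Second coordinates of the same two vectors: that of g (x, y) is 0.\<close>
  have "[x * (g * y) - y * (g * x) = x * (t * w) - y * (t * z)] (mod int n)"
    using tg by (intro cong_diff cong_mult[OF cong_refl])
  then have "int n dvd x * (t * w) - y * (t * z)"
    by (simp add: cong_dvd_iff algebra_simps cong_0_iff cong_sym_eq)
  also have "x * (t * w) - y * (t * z) = g * (t' * Y)" by (simp add: t' Y_def algebra_simps)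
  finally have Y0: "m dvd t' * Y" unfolding m using g0 by simp
  have "coprime m t'"
  proof (rule coprimeI)
    fix e assume e: "e dvd m" "e dvd t'"
    have "e dvd 1 - t' * (A * z + B * w) + t' * (A * z + B * w)"
      using dvd_trans[OF e(1) X1] e(2) by (intro dvd_add dvd_mult2)
    then show "is_unit e" by simp
  qed
  then have mY: "m dvd Y" using Y0 by (simp add: coprime_dvd_mult_right_iff)
  \<comment> \<open>Second coordinates of m (-B, A) and s (z, w): dividing by m gives s' Y = 1
    modulo g.\<close>
  have "[x * (m * A) - y * (- (m * B)) = x * (s * w) - y * (s * z)] (mod int n)"
    using sm by (intro cong_diff cong_mult[OF cong_refl])
  also have "x * (m * A) - y * (- (m * B)) = m * (A * x + B * y)" by (simp add: algebra_simps)
  finally have "m * g dvd m * (1 - s' * Y)"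
    unfolding AB m by (simp add: cong_iff_dvd_diff s' Y_def algebra_simps)
  then have Y1: "g dvd 1 - s' * Y" using m0 by simp
  show ?thesis
  proof (rule coprimeI)
    fix e assume e: "e dvd g" "e dvd m"
    have "e dvd 1 - s' * Y + s' * Y"
      using dvd_trans[OF e(1) Y1] dvd_trans[OF e(2) mY] by (intro dvd_add dvd_mult)
    then show "is_unit e" by simp
  qed
qed

section \<open>Coprimality of g and m in terms of the prime power components\<close>

lemma component_iff:
  assumes "prime p" "1 \<le> e"
  shows "reduce_pair (p ^ e) (b, c) = (0, 0) \<or> admissible (p ^ e) (reduce_pair (p ^ e) (b, c)) \<longleftrightarrow>
    int p ^ e dvd gcd b c \<or> \<not> int p dvd gcd b c"
proof -
  have gt: "1 < p ^ e" using assms by (intro one_less_power prime_gt_1_nat) auto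
  have pp: "prime (int p)" using assms by simp
  have "admissible (p ^ e) (reduce_pair (p ^ e) (b, c)) \<longleftrightarrow> coprime (gcd b c) (int p ^ e)"
    using gt prime_gt_0_nat[OF assms(1)] gcd_reduce_pair[of b "int p ^ e" c]
    by (simp add: reduce_pair_def admissible_iff carrier_Zmod_square coprime_iff_gcd_eq_1)
  also have "\<dots> \<longleftrightarrow> coprime (gcd b c) (int p)" using assms(2) by auto
  also have "\<dots> \<longleftrightarrow> \<not> int p dvd gcd b c"
    using pp by (metis coprime_commute coprime_common_divisor dvd_refl not_prime_unit prime_imp_coprime)
  finally show ?thesis
    by (auto simp: reduce_pair_def mod_eq_0_iff_dvd)
qed

text \<open>If g and m are coprime, a prime p_k dividing a divides g but not m, so its whole power
  in d = g m goes into g. Conversely, a common prime of g and m is some p_k whose full power divides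
  g; with one more factor from m, it occurs too often in d.\<close>

lemma coprime_cofactor_iff_components:
  fixes p \<epsilon> :: "'i \<Rightarrow> nat" and g m a :: int
  assumes I: "finite I" "inj_on p I" "\<forall>k\<in>I. prime (p k)" "\<forall>k\<in>I. 1 \<le> \<epsilon> k"
    and d: "d = (\<Prod>k\<in>I. p k ^ \<epsilon> k)" and m: "int d = g * m" and g: "g = gcd a (int d)"
  shows "coprime g m \<longleftrightarrow> (\<forall>k\<in>I. int (p k) ^ \<epsilon> k dvd a \<or> \<not> int (p k) dvd a)"
proof
  assume cop: "coprime g m"
  show "\<forall>k\<in>I. int (p k) ^ \<epsilon> k dvd a \<or> \<not> int (p k) dvd a"
  proof (intro ballI disjCI notI, simp)
    fix k assume k: "k \<in> I" "int (p k) dvd a"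
    have dk: "int (p k) ^ \<epsilon> k dvd int d"
      using dvd_prodI[OF I(1) k(1), of "\<lambda>k. int (p k) ^ \<epsilon> k"] by (simp add: d)
    moreover have "int (p k) dvd int (p k) ^ \<epsilon> k" using I(4) k(1) by (auto intro: dvd_power)
    ultimately have "int (p k) dvd g" using k(2) unfolding g by (meson dvd_trans gcd_greatest)
    moreover have pp: "prime (int (p k))" using I(3) k(1) by simp
    ultimately have "\<not> int (p k) dvd m"
      using cop coprime_common_divisor not_prime_unit by blast
    then have "coprime (int (p k) ^ \<epsilon> k) m" using prime_imp_coprime[OF pp] by simp
    then have "int (p k) ^ \<epsilon> k dvd g" using dk m by (simp add: coprime_dvd_mult_left_iff)
    then show "int (p k) ^ \<epsilon> k dvd a" unfolding g by simp
  qed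
next
  assume comp: "\<forall>k\<in>I. int (p k) ^ \<epsilon> k dvd a \<or> \<not> int (p k) dvd a"
  have d0: "d > 0" unfolding d using I(3) by (auto intro!: prod_pos simp: prime_gt_0_nat)
  show "coprime g m"
  proof (rule ccontr)
    assume "\<not> coprime g m"
    moreover have g0: "g \<noteq> 0" using d0 m by auto
    ultimately have "gcd g m \<noteq> 1" by (simp add: coprime_iff_gcd_eq_1)
    then obtain q' where q': "prime q'" "q' dvd g" "q' dvd m"
      using prime_divisor_exists[of "gcd g m"] g0 by auto
    obtain q where "q' = int q" using prime_ge_0_int[OF q'(1)] by (rule zero_le_imp_eq_int[THEN exE])
    then have q: "q' = int q" "prime q" using q'(1) by auto
    have "int q dvd int d" using q' q m by auto
    then have "q dvd (\<Prod>k\<in>I. p k ^ \<epsilon> k)" unfolding d by (simp only: of_nat_dvd_iff)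
    then obtain k where k: "k \<in> I" "q dvd p k ^ \<epsilon> k"
      using I(1) q(2) by (auto simp: prime_dvd_prod_iff)
    then have qk: "q = p k" using q(2) I(3) by (meson prime_dvd_power primes_dvd_imp_eq)
    define D where "D = (\<Prod>j\<in>I - {k}. p j ^ \<epsilon> j)"
    have dD: "d = q ^ \<epsilon> k * D" unfolding d D_def qk using I(1) k(1) by (rule prod.remove)
    have "int q dvd a" using q' q g by auto
    then have "int q ^ \<epsilon> k dvd a" using comp k(1) qk by auto
    then have "int q ^ \<epsilon> k dvd g" unfolding g dD by simp
    \<comment> \<open>The surplus factor \<open>q\<close> must divide the product \<open>D\<close>
      of the other prime powers, against the distinctness of the primes.\<close>
    then have "int q ^ \<epsilon> k * int q dvd g * m" using q' q by (intro mult_dvd_mono) auto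
    then have "int q ^ \<epsilon> k * int q dvd int q ^ \<epsilon> k * int D" by (simp add: m[symmetric] dD)
    then have "q dvd D" using q(2) by (auto simp: prime_gt_0_nat)
    then obtain j where j: "j \<in> I - {k}" "q dvd p j ^ \<epsilon> j"
      using I(1) q(2) by (auto simp: D_def prime_dvd_prod_iff)
    then have "q = p j" using q(2) I(3) by (meson DiffD1 prime_dvd_power primes_dvd_imp_eq)
    then show False using qk j(1) k(1) I(2) by (auto dest: inj_onD)
  qed
qed

theorem mainTheorem4:
  fixes r d :: nat and p \<epsilon> :: "nat \<Rightarrow> nat" and b c :: int
  assumes "1 \<le> r"
    and "\<forall>k\<in>{1..r}. prime (p k)"
    and "inj_on p {1..r}"
    and "\<forall>k\<in>{1..r}. 1 \<le> \<epsilon> k"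
    and "d = (\<Prod>k=1..r. p k ^ \<epsilon> k)"
    and "(b, c) \<in> carrier (Zmod_square d)"
  shows "generated_submodule d (point_union d (b, c)) = perp_set d (b, c) \<and>
    (point_union d (b, c) = perp_set d (b, c) \<longleftrightarrow>
      (\<forall>k\<in>{1..r}. reduce_pair (p k ^ \<epsilon> k) (b, c) = (0, 0) \<or>
                   admissible (p k ^ \<epsilon> k) (reduce_pair (p k ^ \<epsilon> k) (b, c))))"
proof
  have d0: "d > 0" unfolding assms(5) using assms(2) by (auto intro!: prod_pos simp: prime_gt_0_nat)
  have "p 1 ^ \<epsilon> 1 dvd d" unfolding assms(5) using assms(1) by (intro dvd_prodI) auto
  moreover have "1 < p 1 ^ \<epsilon> 1"
    using assms(1,2,4) by (intro one_less_power prime_gt_1_nat) (auto simp: Suc_le_eq)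
  ultimately have d1: "1 < d" using d0 by (meson dvd_imp_le less_le_trans)
  show "generated_submodule d (point_union d (b, c)) = perp_set d (b, c)"
    using generated_submodule_point_union[OF d1 assms(6)] .
  define g where "g = gcd (gcd b c) (int d)"
  obtain m where m: "int d = g * m" unfolding g_def by (meson dvd_def gcd_dvd2)
  have "point_union d (b, c) = perp_set d (b, c) \<longleftrightarrow> coprime g m"
    using point_union_subset_perp_set[OF d1] perp_set_subset_point_union[OF d1 assms(6) m g_def]
      coprime_if_perp_set_subset_point_union[OF d1 m g_def] by blast
  also have "\<dots> \<longleftrightarrow> (\<forall>k\<in>{1..r}. int (p k) ^ \<epsilon> k dvd gcd b c \<or> \<not> int (p k) dvd gcd b c)"
    by (rule coprime_cofactor_iff_components[OF _ assms(3,2,4,5) m g_def]) simp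
  also have "\<dots> \<longleftrightarrow> (\<forall>k\<in>{1..r}. reduce_pair (p k ^ \<epsilon> k) (b, c) = (0, 0) \<or>
                   admissible (p k ^ \<epsilon> k) (reduce_pair (p k ^ \<epsilon> k) (b, c)))"
    using assms(2,4) component_iff by (intro ball_cong refl) blast
  finally show "point_union d (b, c) = perp_set d (b, c) \<longleftrightarrow>
      (\<forall>k\<in>{1..r}. reduce_pair (p k ^ \<epsilon> k) (b, c) = (0, 0) \<or>
                   admissible (p k ^ \<epsilon> k) (reduce_pair (p k ^ \<epsilon> k) (b, c)))" .
qed

end
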